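(* Let $\mathbf{S}=\mathbf{S}[t_1,t_2,\dots]\in\mathbb{Q}[[t_1,t_2,\dots]]$ be the unique formal power series with constant term $1$ satisfying $$0=1-\mathbf{S}+\sum_{k\ge1} t_k\,\mathbf{S}^{k+1},$$ let $\mathbf{S}_1=t_1+t_2+t_3+\cdots$, and let $\mathbf{G}\in\mathbb{Q}[[t_1,t_2,\dots]]$ be the formal power series with $\mathbf{S}-1=\mathbf{S}_1\,\mathbf{G}$. For non-negative integers $m_1,m_2$, let $G[m_1,m_2]$ denote the coefficient of $t_1^{m_1}t_2^{m_2}$ (with all other variables $t_k$, $k\ge3$, having exponent $0$) in $\mathbf{G}$. Then for all non-negative integers $m_1,m_2$, $$G[m_1,m_2]=\frac{1}{(2m_1+2m_2+3)(m_1+m_2+1)}\cdot\frac{(2m_1+3m_2+3)!}{(m_1+2m_2+2)!\,m_1!\,m_2!}.$$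
   Context: Here $\mathbf{S}$ is the (hyper-Catalan) series solution $\alpha$ of the general polynomial equation $0=1-\alpha+\sum_{k\ge1}t_k\alpha^{k+1}$; note the variable $t_k$ multiplies $\alpha^{k+1}$. It is known that $\mathbf{S}-1$ is divisible by $\mathbf{S}_1$ in the ring of formal power series, so the quotient $\mathbf{G}$ (the "Geode series") is a well-defined formal power series. *)

theory Defs
  imports Complex_Main "HOL-Library.Multiset"
begin

section \<open>Formal power series in arbitrarily many commuting variables\<close>

text \<open>
  A monomial in variables indexed by \<open>'v\<close> is a finitely supported exponent function
  \<open>'v \<Rightarrow> nat\<close>, that is, a multiset over \<open>'v\<close>: \<open>count M v\<close> is the exponent of \<open>v\<close> in \<open>M\<close>,
  \<open>{#}\<close> is the monomial \<open>1\<close>, and \<open>A + B\<close> is the product of the monomials \<open>A\<close> and \<open>B\<close>.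
\<close>

typedef ('v, 'a) mfps = "UNIV :: ('v multiset \<Rightarrow> 'a) set"
  morphisms mfps_coeff Abs_mfps
  by simp

lemma mfps_coeff_Abs [simp]: "mfps_coeff (Abs_mfps f) = f"
  by (simp add: Abs_mfps_inverse)

lemma mfps_eqI: "(\<And>M. mfps_coeff f M = mfps_coeff g M) \<Longrightarrow> f = g"
  by (metis ext mfps_coeff_inject)

lemma finite_mset_splits: "finite {(A, B). A + B = (M :: 'v multiset)}"
proof (rule finite_subset)
  show "{(A, B). A + B = M} \<subseteq> {A. A \<subseteq># M} \<times> {A. A \<subseteq># M}"
    by auto
  show "finite ({A. A \<subseteq># M} \<times> {A. A \<subseteq># M})"
  proof -
    have "finite {A. A \<subseteq># M}"
    proof (induction M)
      case empty
      then show ?case by simp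
    next
      case (add x M)
      have "{A. A \<subseteq># add_mset x M} \<subseteq> {A. A \<subseteq># M} \<union> add_mset x ` {A. A \<subseteq># M}"
      proof
        fix A assume "A \<in> {A. A \<subseteq># add_mset x M}"
        then have A: "A \<subseteq># add_mset x M" by simp
        show "A \<in> {A. A \<subseteq># M} \<union> add_mset x ` {A. A \<subseteq># M}"
        proof (cases "x \<in># A")
          case True
          then obtain B where "A = add_mset x B" by (metis insert_DiffM)
          with A show ?thesis by auto
        next
          case False
          with A show ?thesis by (metis UnI1 diff_single_trivial mem_Collect_eq subset_eq_diff_conv add_mset_add_single)
        qed
      qed
      with add show ?case by (meson finite_UnI finite_imageI finite_subset)
    qed
    then show ?thesis by simp
  qed
qed

instantiation mfps :: (type, comm_ring_1) comm_ring_1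
begin

definition zero_mfps_def: "0 = Abs_mfps (\<lambda>M. 0)"

definition one_mfps_def: "1 = Abs_mfps (\<lambda>M. if M = {#} then 1 else 0)"

definition plus_mfps_def: "f + g = Abs_mfps (\<lambda>M. mfps_coeff f M + mfps_coeff g M)"

definition minus_mfps_def: "f - g = Abs_mfps (\<lambda>M. mfps_coeff f M - mfps_coeff g M)"

definition uminus_mfps_def: "- f = Abs_mfps (\<lambda>M. - mfps_coeff f M)"

definition times_mfps_def:
  "f * g = Abs_mfps (\<lambda>M. \<Sum>(A, B) \<in> {(A, B). A + B = M}. mfps_coeff f A * mfps_coeff g B)"

instance
proof
  fix f g h :: "('a, 'b) mfps"
  show "f + g + h = f + (g + h)" "f + g = g + f" "0 + f = f" "- f + f = 0" "f - g = f + - g"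
    by (simp_all add: zero_mfps_def plus_mfps_def minus_mfps_def uminus_mfps_def algebra_simps)
      (simp_all add: mfps_coeff_inverse)
  show "f * g = g * f"
  proof (rule mfps_eqI)
    fix M
    show "mfps_coeff (f * g) M = mfps_coeff (g * f) M"
      unfolding times_mfps_def mfps_coeff_Abs
      by (rule sum.reindex_bij_witness[of _ prod.swap prod.swap])
        (auto simp: add.commute mult.commute)
  qed
  show "1 * f = f"
  proof (rule mfps_eqI)
    fix M
    have "mfps_coeff (1 * f) M =
        (\<Sum>(A, B) \<in> {(A, B). A + B = M}. if A = {#} then mfps_coeff f B else 0)"
      unfolding times_mfps_def one_mfps_def mfps_coeff_Abs by (rule sum.cong) auto
    also have "\<dots> = (\<Sum>(A, B) \<in> {({#} :: 'a multiset, M)}. if A = {#} then mfps_coeff f B else 0)"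
      by (rule sum.mono_neutral_right, rule finite_mset_splits) (auto split: if_splits)
    finally show "mfps_coeff (1 * f) M = mfps_coeff f M" by simp
  qed
  show "(f + g) * h = f * h + g * h"
    by (rule mfps_eqI)
      (simp add: times_mfps_def plus_mfps_def algebra_simps sum.distrib split_beta)
  show "f * g * h = f * (g * h)"
  proof (rule mfps_eqI)
    fix M
    let ?S = "\<lambda>M :: 'a multiset. {(A, B). A + B = M}"
    have "mfps_coeff (f * g * h) M =
        (\<Sum>p\<in>?S M. \<Sum>q\<in>?S (fst p).
           mfps_coeff f (fst q) * mfps_coeff g (snd q) * mfps_coeff h (snd p))"
      by (simp add: times_mfps_def sum_distrib_right split_beta)
    also have "\<dots> = (\<Sum>(p, q)\<in>(SIGMA p:?S M. ?S (fst p)).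
           mfps_coeff f (fst q) * mfps_coeff g (snd q) * mfps_coeff h (snd p))"
      by (rule sum.Sigma) (auto simp: finite_mset_splits)
    also have "\<dots> = (\<Sum>(p, q)\<in>(SIGMA p:?S M. ?S (snd p)).
           mfps_coeff f (fst p) * (mfps_coeff g (fst q) * mfps_coeff h (snd q)))"
      by (rule sum.reindex_bij_witness[of _
            "\<lambda>((a, bc), (b, c)). ((a + b, c), (a, b))" "\<lambda>((ab, c), (a, b)). ((a, b + c), (b, c))"])
        (auto simp: algebra_simps)
    also have "\<dots> = (\<Sum>p\<in>?S M. \<Sum>q\<in>?S (snd p).
           mfps_coeff f (fst p) * (mfps_coeff g (fst q) * mfps_coeff h (snd q)))"
      by (rule sum.Sigma[symmetric]) (auto simp: finite_mset_splits)
    also have "\<dots> = mfps_coeff (f * (g * h)) M"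
      by (simp add: times_mfps_def sum_distrib_left split_beta)
    finally show "mfps_coeff (f * g * h) M = mfps_coeff (f * (g * h)) M" .
  qed
  have "mfps_coeff (0 :: ('a, 'b) mfps) {#} \<noteq> mfps_coeff 1 {#}"
    by (simp add: zero_mfps_def one_mfps_def)
  then show "(0 :: ('a, 'b) mfps) \<noteq> 1"
    by (rule contrapos_nn) simp
qed

end

definition mfps_var :: "'v \<Rightarrow> ('v, 'a::comm_ring_1) mfps" where
  "mfps_var v = Abs_mfps (\<lambda>M. if M = {#v#} then 1 else 0)"

text \<open>
  A family of power series is summable if every monomial has a nonzero coefficient in only
  finitely many of its members; its sum is then formed coefficientwise.
\<close>

definition mfps_summable :: "('i \<Rightarrow> ('v, 'a::comm_ring_1) mfps) \<Rightarrow> 'i set \<Rightarrow> bool" where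
  "mfps_summable F I \<longleftrightarrow> (\<forall>M. finite {i \<in> I. mfps_coeff (F i) M \<noteq> 0})"

definition mfps_infsum :: "('i \<Rightarrow> ('v, 'a::comm_ring_1) mfps) \<Rightarrow> 'i set \<Rightarrow> ('v, 'a) mfps" where
  "mfps_infsum F I = Abs_mfps (\<lambda>M. \<Sum>i | i \<in> I \<and> mfps_coeff (F i) M \<noteq> 0. mfps_coeff (F i) M)"


section \<open>The ring of formal power series in $t_1, t_2, \dots$\<close>

text \<open>
  The variable $t_k$ ($k \ge 1$) has index \<open>k - 1\<close>, so that the index type \<open>nat\<close> enumerates
  exactly the variables $t_1, t_2, \dots$ (and there is no $t_0$).
\<close>

definition t_var :: "nat \<Rightarrow> (nat, rat) mfps" where
  "t_var k = mfps_var (k - 1)"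

definition S1 :: "(nat, rat) mfps" where
  "S1 = mfps_infsum t_var {1..}"

definition t_monom2 :: "nat \<Rightarrow> nat \<Rightarrow> nat multiset" where
  "t_monom2 m1 m2 = replicate_mset m1 (1 - 1) + replicate_mset m2 (2 - 1)"

lemma mfps_coeff_var_mult:
  "mfps_coeff (mfps_var v * f) M = (if v \<in># M then mfps_coeff f (M - {#v#}) else 0)"
proof -
  have "mfps_coeff (mfps_var v * f) M =
      (\<Sum>(A, B) \<in> {(A, B). A + B = M}. if A = {#v#} then mfps_coeff f B else 0)"
    unfolding times_mfps_def mfps_var_def mfps_coeff_Abs by (rule sum.cong) auto
  also have "\<dots> = (\<Sum>(A, B) \<in> {(A, B). A + B = M \<and> A = {#v#}}.
      if A = {#v#} then mfps_coeff f B else 0)"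
    by (rule sum.mono_neutral_right, rule finite_mset_splits) (auto split: if_splits)
  also have "{(A, B). A + B = M \<and> A = {#v#}} = (if v \<in># M then {({#v#}, M - {#v#})} else {})"
    by auto
  finally show ?thesis by simp
qed

lemma mfps_coeff_t_monom2:
  "mfps_coeff (t_var 1 ^ m1 * t_var 2 ^ m2) M = (if M = t_monom2 m1 m2 then 1 else 0)"
proof (induction m1 arbitrary: M)
  case 0
  show ?case
  proof (induction m2 arbitrary: M)
    case 0
    have "t_monom2 0 0 = {#}" by (simp add: t_monom2_def)
    then show ?case by (simp only: power_0 mult_1_left) (simp add: one_mfps_def)
  next
    case (Suc m2)
    then show ?case
      by (auto simp: t_var_def t_monom2_def mfps_coeff_var_mult dest: insert_DiffM)
  qed
next
  case (Suc m1)
  then show ?case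
    by (auto simp: t_var_def t_monom2_def mfps_coeff_var_mult mult.assoc dest: insert_DiffM)
qed

lemma mfps_summable_t_var_mult: "mfps_summable (\<lambda>k. t_var k * F k) {1..}"
  unfolding mfps_summable_def
proof
  fix M :: "nat multiset"
  have "{k \<in> {1..}. mfps_coeff (t_var k * F k) M \<noteq> 0} \<subseteq> Suc ` set_mset M"
  proof
    fix k assume "k \<in> {k \<in> {1..}. mfps_coeff (t_var k * F k) M \<noteq> 0}"
    then have "k = Suc (k - 1)" and "k - 1 \<in># M"
      by (auto simp: t_var_def mfps_coeff_var_mult split: if_splits)
    then show "k \<in> Suc ` set_mset M" by (rule image_eqI)
  qed
  then show "finite {k \<in> {1..}. mfps_coeff (t_var k * F k) M \<noteq> 0}"
    by (rule finite_subset) simp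
qed

lemma mfps_summable_t_var: "mfps_summable t_var {1..}"
  using mfps_summable_t_var_mult[of "\<lambda>_. 1"] by simp

end

theory Submission
  imports Defs
begin

text \<open>
  Setting \<open>t\<^sub>k = 0\<close> for \<open>k \<ge> 3\<close> turns the defining equation, multiplied by \<open>S ^ n\<close>, into
  \<open>S ^ (n + 1) = S ^ n + t\<^sub>1 S ^ (n + 2) + t\<^sub>2 S ^ (n + 3)\<close>. This is linear in the powers of \<open>S\<close>
  and determines the coefficients of all of them by induction on the degree and on \<open>n\<close>, so the
  closed form of these coefficients only has to be checked against the recurrence. The
  coefficients of \<open>G\<close> are then determined, by induction on the exponent of \<open>t\<^sub>2\<close>, by
  \<open>S - 1 = (t\<^sub>1 + t\<^sub>2) G\<close>.
\<close>

lemma mfps_coeff_plus: "mfps_coeff (f + g) M = mfps_coeff f M + mfps_coeff g M"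
  by (simp add: plus_mfps_def)

lemma mfps_coeff_minus: "mfps_coeff (f - g) M = mfps_coeff f M - mfps_coeff g M"
  by (simp add: minus_mfps_def)

lemma mfps_coeff_one: "mfps_coeff 1 M = (if M = {#} then 1 else 0)"
  by (simp add: one_mfps_def)

text \<open>The Cauchy product at \<open>M\<close> only sees divisors of \<open>M\<close>, and
  monomials in t_1, t_2 are closed under divisors. Truncating the infinite sum is therefore
  legitimate inside a product as well.\<close>

lemma mfps_coeff_times_cong:
  assumes "\<And>A. A \<subseteq># M \<Longrightarrow> mfps_coeff f A = mfps_coeff f' A"
  shows "mfps_coeff (f * g) M = mfps_coeff (f' * g) M"
  unfolding times_mfps_def mfps_coeff_Abs by (rule sum.cong) (auto simp: assms)

text \<open>The indices 0 and 1 stand for t_1 and t_2, so no t_k with k >= 3 divides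
  \<open>M\<close>.\<close>

lemma mfps_coeff_infsum_t_var_mult:
  assumes "set_mset M \<subseteq> {0, 1}"
  shows "mfps_coeff (mfps_infsum (\<lambda>k. t_var k * F k) {1..}) M =
    mfps_coeff (t_var 1 * F 1 + t_var 2 * F 2) M"
proof -
  let ?c = "\<lambda>k. mfps_coeff (t_var k * F k) M"
  have "{k. k \<in> {1..} \<and> ?c k \<noteq> 0} \<subseteq> {1, 2}"
    using assms by (auto simp: t_var_def mfps_coeff_var_mult split: if_splits)
  then have "(\<Sum>k | k \<in> {1..} \<and> ?c k \<noteq> 0. ?c k) = (\<Sum>k\<in>{1, 2}. ?c k)"
    by (intro sum.mono_neutral_left) auto
  then show ?thesis by (simp add: mfps_infsum_def mfps_coeff_plus)
qed

lemma mfps_coeff_infsum_t_var_mult_times: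
  assumes "set_mset M \<subseteq> {0, 1}"
  shows "mfps_coeff (mfps_infsum (\<lambda>k. t_var k * F k) {1..} * g) M =
    mfps_coeff (t_var 1 * (F 1 * g)) M + mfps_coeff (t_var 2 * (F 2 * g)) M"
proof -
  have "mfps_coeff (mfps_infsum (\<lambda>k. t_var k * F k) {1..} * g) M =
      mfps_coeff ((t_var 1 * F 1 + t_var 2 * F 2) * g) M"
    by (intro mfps_coeff_times_cong mfps_coeff_infsum_t_var_mult)
      (use assms in \<open>meson set_mset_mono subset_trans\<close>)
  then show ?thesis by (simp add: algebra_simps mfps_coeff_plus)
qed

lemma set_mset_t_monom2: "set_mset (t_monom2 a b) \<subseteq> {0, 1}"
  by (auto simp: t_monom2_def)

lemma t_monom2_eq_empty_iff: "t_monom2 a b = {#} \<longleftrightarrow> a = 0 \<and> b = 0"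
  by (auto simp: t_monom2_def)

lemma mfps_coeff_t_var_1_mult_t_monom2:
  "mfps_coeff (t_var 1 * f) (t_monom2 a b) =
    (if a = 0 then 0 else mfps_coeff f (t_monom2 (a - 1) b))"
  by (cases a) (auto simp: t_var_def t_monom2_def mfps_coeff_var_mult)

lemma mfps_coeff_t_var_2_mult_t_monom2:
  "mfps_coeff (t_var 2 * f) (t_monom2 a b) =
    (if b = 0 then 0 else mfps_coeff f (t_monom2 a (b - 1)))"
  by (cases b) (auto simp: t_var_def t_monom2_def mfps_coeff_var_mult)

lemmas mfps_coeff_t_var_mult_t_monom2 =
  mfps_coeff_t_var_1_mult_t_monom2 mfps_coeff_t_var_2_mult_t_monom2

text \<open>
  At \<open>n = a = b = 0\<close> truncated subtraction gives \<open>0\<close>, whereas the coefficient of \<open>S ^ 0\<close> is \<open>1\<close>.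
\<close>

definition hyper_catalan_power :: "nat \<Rightarrow> nat \<Rightarrow> nat \<Rightarrow> rat" where
  "hyper_catalan_power n a b =
    of_nat n * fact (2 * a + 3 * b + n - 1) / (fact (a + 2 * b + n) * fact a * fact b)"

lemma hyper_catalan_power_0_0: "n > 0 \<Longrightarrow> hyper_catalan_power n 0 0 = 1"
  by (cases n) (auto simp: hyper_catalan_power_def)

text \<open>Every term is a polynomial times \<open>p / d\<close>, where \<open>d\<close> is the
  denominator of the left-hand side. What remains is (n+1)(2a+3b+n) = n(a+2b+n+1) + (n+2)a +
  (n+3)b.\<close>

lemma hyper_catalan_power_rec:
  assumes "a > 0 \<or> b > 0"
  shows "hyper_catalan_power (Suc n) a b = hyper_catalan_power n a b +
    (if a = 0 then 0 else hyper_catalan_power (n + 2) (a - 1) b) +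
    (if b = 0 then 0 else hyper_catalan_power (n + 3) a (b - 1))"
proof -
  define p where "p = (fact (2 * a + 3 * b + n - 1) :: rat)"
  define q where "q = (fact (a + 2 * b + n) :: rat)"
  define d where "d = q * (of_nat (a + 2 * b + n) + 1) * fact a * fact b"
  have nz: "(of_nat (a + 2 * b + n) + 1 :: rat) \<noteq> 0"
    by (metis of_nat_Suc of_nat_neq_0 add.commute)
  have "hyper_catalan_power (Suc n) a b = of_nat (n + 1) * (of_nat (2 * a + 3 * b + n) * p) / d"
  proof -
    \<comment> \<open>Since a or b is positive, the subtraction in \<open>p\<close> does not
      truncate.\<close>
    have "2 * a + 3 * b + n = Suc (2 * a + 3 * b + n - 1)" using assms by auto
    then have "fact (2 * a + 3 * b + n) = of_nat (2 * a + 3 * b + n) * p"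
      unfolding p_def by (metis fact_Suc)
    then show ?thesis
      by (simp add: hyper_catalan_power_def d_def q_def algebra_simps)
  qed
  moreover have "hyper_catalan_power n a b = of_nat n * p * (of_nat (a + 2 * b + n) + 1) / d"
    using nz by (simp add: hyper_catalan_power_def d_def p_def q_def)
  \<comment> \<open>The shift from (n, a) to (n+2, a-1) preserves 2a+3b+n, so the numerator is again
    \<open>p\<close>; the factor \<open>of_nat a\<close> absorbs the case a = 0.\<close>
  moreover have "(if a = 0 then 0 else hyper_catalan_power (n + 2) (a - 1) b) =
      of_nat (n + 2) * p * of_nat a / d"
  proof (cases a)
    case (Suc c)
    have "p = fact (2 * c + 3 * b + (n + 2) - 1)"
      "fact (c + 2 * b + (n + 2)) = q * (of_nat (a + 2 * b + n) + 1)"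
      unfolding p_def q_def Suc by (simp_all add: algebra_simps)
    moreover have "(fact a :: rat) = of_nat a * fact c" unfolding Suc by (rule fact_Suc)
    moreover have "(of_nat a :: rat) \<noteq> 0" unfolding Suc by (rule of_nat_neq_0)
    ultimately show ?thesis
      unfolding hyper_catalan_power_def d_def by (simp add: Suc del: of_nat_add of_nat_Suc fact_Suc)
  qed simp
  moreover have "(if b = 0 then 0 else hyper_catalan_power (n + 3) a (b - 1)) =
      of_nat (n + 3) * p * of_nat b / d"
  proof (cases b)
    case (Suc c)
    have "p = fact (2 * a + 3 * c + (n + 3) - 1)"
      "fact (a + 2 * c + (n + 3)) = q * (of_nat (a + 2 * b + n) + 1)"
      unfolding p_def q_def Suc by (simp_all add: algebra_simps eval_nat_numeral)
    moreover have "(fact b :: rat) = of_nat b * fact c" unfolding Suc by (rule fact_Suc)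
    moreover have "(of_nat b :: rat) \<noteq> 0" unfolding Suc by (rule of_nat_neq_0)
    ultimately show ?thesis
      unfolding hyper_catalan_power_def d_def by (simp add: Suc del: of_nat_add of_nat_Suc fact_Suc)
  qed simp
  moreover have "of_nat (n + 1) * (of_nat (2 * a + 3 * b + n) * p) =
      of_nat n * p * (of_nat (a + 2 * b + n) + 1) + of_nat (n + 2) * p * of_nat a +
      of_nat (n + 3) * p * of_nat b"
    by (simp add: algebra_simps)
  ultimately show ?thesis by (simp only: add_divide_distrib)
qed

lemma mfps_coeff_power_t_monom2:
  assumes "0 = 1 - S + mfps_infsum (\<lambda>k. t_var k * S ^ (k + 1)) {1..}"
    and "n > 0 \<or> a > 0 \<or> b > 0"
  shows "mfps_coeff (S ^ n) (t_monom2 a b) = hyper_catalan_power n a b"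
  using assms(2)
proof (induction "a + b" arbitrary: a b n rule: less_induct)
  case less
  note degree_IH = less.hyps
  have S: "S = 1 + mfps_infsum (\<lambda>k. t_var k * S ^ (k + 1)) {1..}"
    using assms(1) by (simp add: algebra_simps)
  have rec: "mfps_coeff (S ^ Suc n) (t_monom2 a b) = mfps_coeff (S ^ n) (t_monom2 a b) +
      (if a = 0 then 0 else mfps_coeff (S ^ (n + 2)) (t_monom2 (a - 1) b)) +
      (if b = 0 then 0 else mfps_coeff (S ^ (n + 3)) (t_monom2 a (b - 1)))" for n
  proof -
    have power_S: "S ^ Suc n = S ^ n + mfps_infsum (\<lambda>k. t_var k * S ^ (k + 1)) {1..} * S ^ n"
      by (subst power_Suc, subst S) (simp add: algebra_simps)
    show ?thesis
      unfolding power_S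
      by (simp only: mfps_coeff_plus mfps_coeff_infsum_t_var_mult_times[OF set_mset_t_monom2]
          mfps_coeff_t_var_mult_t_monom2 flip: power_add) (simp add: eval_nat_numeral)
  qed
  \<comment> \<open>The recurrence lowers the degree but raises the exponent of S, so
    \<open>degree_IH\<close> must cover all exponents; the remaining term S^n of equal degree calls
    for an inner induction on n.\<close>
  show ?case
    using less.prems
  proof (induction n)
    case 0
    then show ?case
      by (simp add: mfps_coeff_one t_monom2_eq_empty_iff hyper_catalan_power_def)
  next
    case (Suc n)
    show ?case
    proof (cases "a > 0 \<or> b > 0")
      case True
      then have "mfps_coeff (S ^ n) (t_monom2 a b) = hyper_catalan_power n a b"
        by (intro Suc.IH) auto
      then show ?thesis
        unfolding rec hyper_catalan_power_rec[OF True] by (auto simp: degree_IH simp del: add_2_eq_Suc' power_Suc)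
    next
      \<comment> \<open>For the constant term the closed form fails at n = 0, so S^1 is obtained
        directly from S^0 = 1 and only higher powers use \<open>Suc.IH\<close>.\<close>
      case False
      then show ?thesis
        using rec[of n] Suc.IH
        by (cases n) (simp_all add: hyper_catalan_power_0_0 mfps_coeff_one t_monom2_eq_empty_iff)
    qed
  qed
qed

definition geode2 :: "nat \<Rightarrow> nat \<Rightarrow> rat" where
  "geode2 a b = 1 / of_nat ((2 * a + 2 * b + 3) * (a + b + 1)) *
    (fact (2 * a + 3 * b + 3) / (fact (a + 2 * b + 2) * fact a * fact b))"

text \<open>This is S - 1 = (t_1 + t_2) G at t_1^(a+1) t_2^b, for the claimed coefficients. Over the
  common denominator \<open>d\<close> it becomes (2a+2b+3)(a+b+1) = (2a+3b+3)(a+1) +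
  (a+2b+2)b.\<close>

lemma geode2_rec:
  "hyper_catalan_power 1 (Suc a) b = geode2 a b + (if b = 0 then 0 else geode2 (Suc a) (b - 1))"
proof -
  define p where "p = (fact (2 * a + 3 * b + 2) :: rat)"
  define q where "q = (fact (a + 2 * b + 2) :: rat)"
  \<comment> \<open>Both factors depend only on a + b, hence are the same for
    \<open>geode2 a b\<close> and \<open>geode2 (Suc a) (b - 1)\<close>.\<close>
  define u v where "u = (of_nat (2 * a + 2 * b + 3) :: rat)" and "v = (of_nat (a + b + 1) :: rat)"
  define d where "d = u * v * q * fact (Suc a) * fact b"
  have nz: "u \<noteq> 0" "v \<noteq> 0" "q \<noteq> 0" unfolding u_def v_def q_def of_nat_eq_0_iff by simp_all
  have "hyper_catalan_power 1 (Suc a) b = p * u * v / d"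
    using nz by (simp add: hyper_catalan_power_def d_def p_def q_def)
  moreover have "geode2 a b = of_nat (2 * a + 3 * b + 3) * p * of_nat (Suc a) / d"
  proof -
    have "(fact (2 * a + 3 * b + 3) :: rat) = of_nat (2 * a + 3 * b + 3) * p"
      unfolding p_def by (simp add: eval_nat_numeral)
    moreover have "(fact (Suc a) :: rat) = of_nat (Suc a) * fact a" by (rule fact_Suc)
    moreover have "(of_nat (Suc a) :: rat) \<noteq> 0" by (rule of_nat_neq_0)
    ultimately show ?thesis
      unfolding geode2_def d_def u_def v_def q_def of_nat_mult by (simp del: of_nat_add of_nat_Suc)
  qed
  moreover have "(if b = 0 then 0 else geode2 (Suc a) (b - 1)) =
      p * of_nat (a + 2 * b + 2) * of_nat b / d"
  proof (cases b)
    case (Suc c)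
    have "p = fact (2 * Suc a + 3 * c + 3)"
      unfolding p_def Suc by (rule arg_cong[where f = fact]) simp
    moreover have "q = of_nat (a + 2 * b + 2) * fact (Suc a + 2 * c + 2)"
      unfolding q_def Suc by (simp add: eval_nat_numeral)
    moreover have "u = of_nat (2 * Suc a + 2 * c + 3)" "v = of_nat (Suc a + c + 1)"
      unfolding u_def v_def Suc by simp_all
    moreover have "(fact b :: rat) = of_nat b * fact c" unfolding Suc by (rule fact_Suc)
    moreover have "(of_nat b :: rat) \<noteq> 0" "(of_nat (a + 2 * b + 2) :: rat) \<noteq> 0"
      unfolding Suc of_nat_eq_0_iff by simp_all
    ultimately show ?thesis
      unfolding geode2_def d_def of_nat_mult
      by (simp add: Suc del: of_nat_add of_nat_Suc fact_Suc)
  qed simp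
  moreover have "u * v =
      of_nat (2 * a + 3 * b + 3) * of_nat (Suc a) + of_nat (a + 2 * b + 2) * of_nat b"
    unfolding u_def v_def by (simp add: algebra_simps)
  ultimately show ?thesis
    by (simp add: add_divide_distrib[symmetric] mult.assoc distrib_left[symmetric] mult.left_commute
        del: of_nat_add of_nat_Suc)
qed

theorem theorem1p1:
  fixes S G :: "(nat, rat) mfps" and m1 m2 :: nat
  assumes "mfps_coeff S {#} = 1"
    and "0 = 1 - S + mfps_infsum (\<lambda>k. t_var k * S ^ (k + 1)) {1..}"
    and "S - 1 = S1 * G"
  shows "mfps_coeff G (t_monom2 m1 m2) =
    1 / of_nat ((2 * m1 + 2 * m2 + 3) * (m1 + m2 + 1)) *
    (fact (2 * m1 + 3 * m2 + 3) / (fact (m1 + 2 * m2 + 2) * fact m1 * fact m2))"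
proof -
  \<comment> \<open>Taking the exponent of t_1 to be a + 1 isolates G at (a, b): the other term has
    a smaller exponent of t_2.\<close>
  have rec: "hyper_catalan_power 1 (Suc a) b = mfps_coeff G (t_monom2 a b) +
      (if b = 0 then 0 else mfps_coeff G (t_monom2 (Suc a) (b - 1)))" for a b
  proof -
    have "hyper_catalan_power 1 (Suc a) b = mfps_coeff (S - 1) (t_monom2 (Suc a) b)"
      using mfps_coeff_power_t_monom2[OF assms(2), of 1 "Suc a" b]
      by (simp add: mfps_coeff_minus mfps_coeff_one t_monom2_eq_empty_iff)
    also have "\<dots> = mfps_coeff (t_var 1 * G) (t_monom2 (Suc a) b) +
        mfps_coeff (t_var 2 * G) (t_monom2 (Suc a) b)"
      \<comment> \<open>The constant family 1 turns the general sum into \<open>S1\<close>.\<close>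
      using mfps_coeff_infsum_t_var_mult_times[OF set_mset_t_monom2, of "\<lambda>_. 1"]
      by (simp add: assms(3) S1_def)
    finally show ?thesis by (simp only: mfps_coeff_t_var_mult_t_monom2) simp
  qed
  have "mfps_coeff G (t_monom2 a b) = geode2 a b" for a b
  \<comment> \<open>The step at (a, b+1) needs the value at (a+1, b), so a must vary.\<close>
  proof (induction b arbitrary: a)
    case 0
    show ?case using rec[of a 0] geode2_rec[of a 0] by simp
  next
    case (Suc b)
    show ?case using rec[of a "Suc b"] geode2_rec[of a "Suc b"] Suc.IH[of "Suc a"] by simp
  qed
  then show ?thesis by (simp only: geode2_def)
qed

end
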